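(* Let $\mathcal{R}$ be a commutative Euclidean domain, $X$ a finite alphabet, $\mathcal{P}=\mathcal{R}\langle X\rangle$ the free associative $\mathcal{R}$-algebra on $X$, and fix a monomial well-ordering $\preceq$ on the set $\mathcal{B}=\langle X\rangle$ of words. Let $\mathcal{G}\subseteq\mathcal{P}\setminus\{0\}$. Then $\mathcal{G}$ is a strong Gröbner basis for the two-sided ideal $\langle\mathcal{G}\rangle$ if and only if for every pair $f,g\in\mathcal{G}$ their first and second type S-polynomials and G-polynomials reduce to zero with respect to $\mathcal{G}$.
   Context: **Setting.** $\mathcal{B}=\langle X\rangle$ is the free monoid of words on $X$ (empty word $1$); its elements are monomials. $\mathcal{P}^e=\mathcal{P}\otimes_{\mathcal{R}}\mathcal{P}^{\mathrm{opp}}$ has $\mathcal{R}$-basis $\mathcal{B}^e=\{u\otimes v: u,v\in\mathcal{B}\}$ and acts on $\mathcal{P}$ by $(u\otimes v)\cdot t=utv$. $|\cdot|$ denotes the Euclidean norm on $\mathcal{R}$ and also the length of a word. For $f\in\mathcal{P}\setminus\{0\}$, $\mathrm{lm}(f)\in\mathcal{B}$, $\mathrm{lc}(f)\in\mathcal{R}$ and $\mathrm{lt}(f)=\mathrm{lc}(f)\mathrm{lm}(f)$ are the leading monomial, coefficient and term with respect to $\preceq$. A word $u$ divides a word $v$ if $v=\tau\cdot u$ for some $\tau\in\mathcal{B}^e$; a term $c\,u$ divides a term $c'v$ if $c\mid c'$ in $\mathcal{R}$ and $u$ divides $v$. **Strong Gröbner basis.** For $\mathcal{S}\subseteq\mathcal{P}$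 let $\mathrm{L}(\mathcal{S})=\langle \mathrm{lt}(f): f\in\mathcal{S}\setminus\{0\}\rangle$ (two-sided ideal). A countable set $\mathcal{G}\subseteq\mathcal{P}\setminus\{0\}$ is a Gröbner basis for a two-sided ideal $\mathcal{I}$ if $\mathrm{L}(\mathcal{I})\subseteq \mathrm{L}(\mathcal{G})$, and a strong Gröbner basis if moreover for every $f'\in\mathcal{I}\setminus\{0\}$ there is $g'\in\mathcal{G}$ such that $\mathrm{lt}(g')$ divides $\mathrm{lt}(f')$. **Reduction.** For nonzero $f,g$, $g$ lm-reduces $f$ if $\mathrm{lm}(f)=\tau\,\mathrm{lm}(g)$ for some $\tau\in\mathcal{B}^e$ and there are $a,b\in\mathcal{R}$ with $a\ne0$, $|b|<|\mathrm{lc}(f)|$ and $\mathrm{lc}(f)=a\,\mathrm{lc}(g)+b$; the lm-reduction of $f$ by $g$ is then $f-a\tau g$. A polynomial reduces to zero with respect to $\mathcal{G}$ if it is zero or there is a finite chain of lm-reductions by elements of $\mathcal{G}$ leading from it to $0$. **Overlaps.** Words $u,v$ have a nontrivial overlap with overlap word $t$ if one of the following holds for some $t_1,t_2\in\mathcal{B}$: (1) $t=ut_1=t_2v$ with $|t_1|<|v|$ and $|t_2|<|u|$; (2) $t=t_1u=vt_2$ with $|t_1|<|v|$ and $|t_2|<|u|$; (3) $t=t_1ut_2=v$; (4) $t=u=t_1vt_2$. The set of all such $t$ is denoted $\mathrm{LCM}(u,v)$. **S- and G-polynomials.** For $f,g\in\mathcal{P}\setminus\{0\}$ let $a_f,a_g\in\mathcal{R}$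 with $\mathrm{lcm}(\mathrm{lc}(f),\mathrm{lc}(g))=a_f\mathrm{lc}(f)=a_g\mathrm{lc}(g)$ and let $b_f,b_g\in\mathcal{R}$ be Bézout coefficients, $\gcd(\mathrm{lc}(f),\mathrm{lc}(g))=b_f\mathrm{lc}(f)+b_g\mathrm{lc}(g)$ (as returned by a fixed implementation of the Euclidean algorithm). First type, with respect to $t\in\mathrm{LCM}(\mathrm{lm}(f),\mathrm{lm}(g))$: for $\tau_f,\tau_g\in\mathcal{B}^e$ with $\tau_f\mathrm{lm}(f)=\tau_g\mathrm{lm}(g)=t$, $\mathrm{spoly}_1^t(f,g)=a_f\tau_f f-a_g\tau_g g$ and $\mathrm{gpoly}_1^t(f,g)=b_f\tau_f f+b_g\tau_g g$. The pair $(\tau_f,\tau_g)$ need not be unique; all such pairs are considered. Second type, with respect to an arbitrary word $w\in\mathcal{B}$: $\mathrm{spoly}_2^w(f,g)=a_f\,f\,w\,\mathrm{lm}(g)-a_g\,\mathrm{lm}(f)\,w\,g$ and $\mathrm{gpoly}_2^w(f,g)=b_f\,f\,w\,\mathrm{lm}(g)+b_g\,\mathrm{lm}(f)\,w\,g$. "Every pair $f,g\in\mathcal{G}$" means every ordered pair, including $f=g$.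
   Formalization: The set G is additionally assumed countable, since a Gröbner basis is countable by definition and the equivalence fails for uncountable G (for example all nonzero constants over the real numbers). *)

theory Defs
  imports
    HOL.Hull
    "HOL-Library.Poly_Mapping"
    "HOL-Library.Countable_Set"
    "HOL-Computational_Algebra.Euclidean_Algorithm"
begin

text \<open>
  Words are lists, i.e. the free monoid. Written additively, this makes
  \<open>'x list \<Rightarrow>\<^sub>0 'a\<close> with its convolution product the free associative algebra over \<open>'a\<close>
  on the alphabet \<open>'x\<close>.
\<close>

instantiation list :: (type) monoid_add
begin
definition zero_list :: "'a list" where "zero_list = []"
definition plus_list :: "'a list \<Rightarrow> 'a list \<Rightarrow> 'a list" where "plus_list u v = u @ v"
instance by standard (simp_all add: zero_list_def plus_list_def)
end

type_synonym ('x, 'a) free_alg = "'x list \<Rightarrow>\<^sub>0 'a"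

definition mon :: "'x list \<Rightarrow> ('x, 'a::comm_ring_1) free_alg"
  where "mon u = Poly_Mapping.single u 1"

definition scal :: "'a::comm_ring_1 \<Rightarrow> ('x, 'a) free_alg"
  where "scal a = Poly_Mapping.single [] a"


subsection \<open>The bimodule action\<close>

text \<open>The basis element \<open>u \<otimes> v\<close> of the enveloping algebra is the pair \<open>(u, v)\<close>.\<close>

fun act_word :: "'x list \<times> 'x list \<Rightarrow> 'x list \<Rightarrow> 'x list"
  where "act_word (u, v) t = u @ t @ v"

fun act :: "'x list \<times> 'x list \<Rightarrow> ('x, 'a::comm_ring_1) free_alg \<Rightarrow> ('x, 'a) free_alg"
  where "act (u, v) f = mon u * f * mon v"

definition word_dvd :: "'x list \<Rightarrow> 'x list \<Rightarrow> bool"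
  where "word_dvd u v \<longleftrightarrow> (\<exists>\<tau>. v = act_word \<tau> u)"

definition term_dvd :: "('x, 'a::comm_ring_1) free_alg \<Rightarrow> ('x, 'a) free_alg \<Rightarrow> bool"
  where "term_dvd s t \<longleftrightarrow> (\<exists>c u c' v. c \<noteq> 0 \<and> c' \<noteq> 0 \<and>
    s = Poly_Mapping.single u c \<and> t = Poly_Mapping.single v c' \<and> c dvd c' \<and> word_dvd u v)"

definition two_sided_ideal :: "'r::ring_1 set \<Rightarrow> bool"
  where "two_sided_ideal I \<longleftrightarrow> 0 \<in> I \<and> (\<forall>x\<in>I. \<forall>y\<in>I. x + y \<in> I) \<and>
    (\<forall>x\<in>I. \<forall>p. p * x \<in> I \<and> x * p \<in> I)"

abbreviation ideal_gen :: "'r::ring_1 set \<Rightarrow> 'r set"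
  where "ideal_gen S \<equiv> two_sided_ideal hull S"


subsection \<open>Leading data\<close>

text \<open>\<open>(u, v) \<in> r\<close> means \<open>u \<preceq> v\<close>. That the empty word is the least word follows.\<close>

definition monomial_well_order :: "'x list rel \<Rightarrow> bool"
  where "monomial_well_order r \<longleftrightarrow> well_order r \<and>
    (\<forall>u v p q. (u, v) \<in> r \<longrightarrow> (p @ u @ q, p @ v @ q) \<in> r)"

text \<open>The leading monomial and leading coefficient are meaningful for nonzero arguments only.\<close>

definition lm :: "'x list rel \<Rightarrow> ('x, 'a::comm_ring_1) free_alg \<Rightarrow> 'x list"
  where "lm r f = (THE u. u \<in> Poly_Mapping.keys f \<and> (\<forall>v\<in>Poly_Mapping.keys f. (v, u) \<in> r))"

definition lc :: "'x list rel \<Rightarrow> ('x, 'a::comm_ring_1) free_alg \<Rightarrow> 'a"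
  where "lc r f = Poly_Mapping.lookup f (lm r f)"

definition lt :: "'x list rel \<Rightarrow> ('x, 'a::comm_ring_1) free_alg \<Rightarrow> ('x, 'a) free_alg"
  where "lt r f = Poly_Mapping.single (lm r f) (lc r f)"


subsection \<open>Groebner bases and reduction\<close>

definition lead_ideal ::
    "'x list rel \<Rightarrow> ('x, 'a::comm_ring_1) free_alg set \<Rightarrow> ('x, 'a) free_alg set"
  where "lead_ideal r S = ideal_gen (lt r ` (S - {0}))"

definition groebner_basis ::
    "'x list rel \<Rightarrow> ('x, 'a::comm_ring_1) free_alg set \<Rightarrow> ('x, 'a) free_alg set \<Rightarrow> bool"
  where "groebner_basis r G I \<longleftrightarrow>
    countable G \<and> 0 \<notin> G \<and> lead_ideal r I \<subseteq> lead_ideal r G"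

definition strong_groebner_basis ::
    "'x list rel \<Rightarrow> ('x, 'a::comm_ring_1) free_alg set \<Rightarrow> ('x, 'a) free_alg set \<Rightarrow> bool"
  where "strong_groebner_basis r G I \<longleftrightarrow> groebner_basis r G I \<and>
    (\<forall>f\<in>I - {0}. \<exists>g\<in>G. term_dvd (lt r g) (lt r f))"

text \<open>
  \<open>lm_reduction r g f h\<close>: \<open>g\<close> lm-reduces \<open>f\<close>, with lm-reduction \<open>h\<close>. The Euclidean norm is
  \<^const>\<open>euclidean_size\<close>, whose value at \<open>0\<close> is smaller than at every nonzero element.
\<close>

definition lm_reduction ::
    "'x list rel \<Rightarrow> ('x, 'a::euclidean_ring) free_alg \<Rightarrow> ('x, 'a) free_alg \<Rightarrow>
      ('x, 'a) free_alg \<Rightarrow> bool"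
  where "lm_reduction r g f h \<longleftrightarrow> f \<noteq> 0 \<and> g \<noteq> 0 \<and>
    (\<exists>\<tau> a b. lm r f = act_word \<tau> (lm r g) \<and> a \<noteq> 0 \<and>
      euclidean_size b < euclidean_size (lc r f) \<and> lc r f = a * lc r g + b \<and>
      h = f - scal a * act \<tau> g)"

definition reduces_to_zero ::
    "'x list rel \<Rightarrow> ('x, 'a::euclidean_ring) free_alg set \<Rightarrow> ('x, 'a) free_alg \<Rightarrow> bool"
  where "reduces_to_zero r G f \<longleftrightarrow> (\<lambda>p q. \<exists>g\<in>G. lm_reduction r g p q)\<^sup>*\<^sup>* f 0"


subsection \<open>Overlaps, S-polynomials and G-polynomials\<close>

definition LCM_words :: "'x list \<Rightarrow> 'x list \<Rightarrow> 'x list set"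
  where "LCM_words u v = {t. \<exists>t1 t2.
    (t = u @ t1 \<and> t = t2 @ v \<and> length t1 < length v \<and> length t2 < length u) \<or>
    (t = t1 @ u \<and> t = v @ t2 \<and> length t1 < length v \<and> length t2 < length u) \<or>
    (t = t1 @ u @ t2 \<and> t = v) \<or>
    (t = u \<and> t = t1 @ v @ t2)}"

text \<open>
  The coefficients \<open>a\<^sub>f\<close> and \<open>a\<^sub>g\<close> with
  \<open>lcm (lc f) (lc g) = a\<^sub>f * lc f = a\<^sub>g * lc g\<close> are the exact quotients.
\<close>

definition cofactor1 ::
    "'x list rel \<Rightarrow> ('x, 'a::euclidean_ring_gcd) free_alg \<Rightarrow> ('x, 'a) free_alg \<Rightarrow> 'a"
  where "cofactor1 r f g = lcm (lc r f) (lc r g) div lc r f"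

definition cofactor2 ::
    "'x list rel \<Rightarrow> ('x, 'a::euclidean_ring_gcd) free_alg \<Rightarrow> ('x, 'a) free_alg \<Rightarrow> 'a"
  where "cofactor2 r f g = lcm (lc r f) (lc r g) div lc r g"

text \<open>A fixed choice of Bezout coefficients, e.g. \<^const>\<open>bezout_coefficients\<close>.\<close>

definition bezout_function :: "('a::euclidean_ring_gcd \<Rightarrow> 'a \<Rightarrow> 'a \<times> 'a) \<Rightarrow> bool"
  where "bezout_function bez \<longleftrightarrow>
    (\<forall>a b. gcd a b = fst (bez a b) * a + snd (bez a b) * b)"

definition spoly1 ::
    "'x list rel \<Rightarrow> 'x list \<times> 'x list \<Rightarrow> 'x list \<times> 'x list \<Rightarrow>
      ('x, 'a::euclidean_ring_gcd) free_alg \<Rightarrow> ('x, 'a) free_alg \<Rightarrow> ('x, 'a) free_alg"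
  where "spoly1 r \<tau>f \<tau>g f g =
    scal (cofactor1 r f g) * act \<tau>f f - scal (cofactor2 r f g) * act \<tau>g g"

definition gpoly1 ::
    "'x list rel \<Rightarrow> ('a::euclidean_ring_gcd \<Rightarrow> 'a \<Rightarrow> 'a \<times> 'a) \<Rightarrow>
      'x list \<times> 'x list \<Rightarrow> 'x list \<times> 'x list \<Rightarrow>
      ('x, 'a) free_alg \<Rightarrow> ('x, 'a) free_alg \<Rightarrow> ('x, 'a) free_alg"
  where "gpoly1 r bez \<tau>f \<tau>g f g =
    scal (fst (bez (lc r f) (lc r g))) * act \<tau>f f +
    scal (snd (bez (lc r f) (lc r g))) * act \<tau>g g"

definition spoly2 ::
    "'x list rel \<Rightarrow> 'x list \<Rightarrow>
      ('x, 'a::euclidean_ring_gcd) free_alg \<Rightarrow> ('x, 'a) free_alg \<Rightarrow> ('x, 'a) free_alg"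
  where "spoly2 r w f g =
    scal (cofactor1 r f g) * f * mon w * mon (lm r g) -
    scal (cofactor2 r f g) * mon (lm r f) * mon w * g"

definition gpoly2 ::
    "'x list rel \<Rightarrow> ('a::euclidean_ring_gcd \<Rightarrow> 'a \<Rightarrow> 'a \<times> 'a) \<Rightarrow> 'x list \<Rightarrow>
      ('x, 'a) free_alg \<Rightarrow> ('x, 'a) free_alg \<Rightarrow> ('x, 'a) free_alg"
  where "gpoly2 r bez w f g =
    scal (fst (bez (lc r f) (lc r g))) * f * mon w * mon (lm r g) +
    scal (snd (bez (lc r f) (lc r g))) * mon (lm r f) * mon w * g"

end

theory Submission
  imports Defs
begin

text \<open>
  If \<open>G\<close> is a strong Groebner basis, every nonzero \<open>f\<close> in the ideal has a leading term that is
  divisible by the leading term of some \<open>g\<close> in \<open>G\<close>. Division with remainder \<open>0\<close> then cancels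
  the leading term of \<open>f\<close>, so well-foundedness of the word order reduces \<open>f\<close> to zero; S- and
  G-polynomials lie in the ideal. This is \<open>sg_polys_reduce_if_strong_groebner_basis\<close>.

  The converse rests on one observation per word \<open>M\<close>: among the elements of \<open>G\<close> whose leading
  word divides \<open>M\<close> there is one, \<open>d\<close>, whose leading coefficient divides all the other leading
  coefficients (\<open>dividing_generator\<close>). Take \<open>d\<close> with leading coefficient of least Euclidean size.
  If it fails to divide \<open>lc f\<close>, then \<open>gcd (lc d) (lc f)\<close> is strictly smaller. It is the
  leading coefficient of a G-polynomial, and a reduction to zero must at some point remove the
  leading word completely. Until then the leading coefficients only shrink, so the element of
  \<open>G\<close> that removes the word has a leading coefficient no larger than the gcd
  (\<open>reduces_to_zero_small_lc\<close>), against the choice of \<open>d\<close>. This argument is needed because a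
  single reduction step may leave a remainder: a G-polynomial that reduces to zero need not have
  a leading term divisible by that of the element which starts the reduction.

  With \<open>d\<close> at hand, S-polynomials do their usual work. Write an element \<open>f\<close> of the ideal as a
  combination of multiples \<open>\<tau> g\<close> whose leading words are at most \<open>M\<close>. Since \<open>lc d\<close> divides
  \<open>lc g\<close>, the factor of \<open>g\<close> in the S-polynomial of \<open>g\<close> and \<open>d\<close> is a unit, so every multiple
  with leading word exactly \<open>M\<close> can be exchanged for a multiple of \<open>d\<close> and multiples with smaller
  leading words (\<open>generator_rewrite\<close>). Hence \<open>f = c \<delta> d + h\<close> with all leading words in \<open>h\<close> below
  \<open>M\<close> (\<open>lead_span_top\<close>). If \<open>c\<close> is nonzero, then \<open>lt d\<close> divides \<open>lt f\<close>; otherwise \<open>M\<close>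
  was not minimal, and the order is well-founded (\<open>lead_span_divisible\<close>).

  The hypothesis covers only minimal overlaps and the juxtapositions \<open>lm f w lm g\<close>. That is
  enough, since any two occurrences in one word either overlap or are separated by a word \<open>w\<close>,
  up to a common context on both sides (\<open>occurrences_ordered\<close>).
\<close>

section \<open>The free algebra as a bimodule over words\<close>

lemma single_eq_scal_mon: "Poly_Mapping.single u c = scal c * mon u"
  by (simp add: scal_def mon_def mult_single plus_list_def)

lemma free_alg_sum:
  "f = (\<Sum>k\<in>Poly_Mapping.keys f. Poly_Mapping.single k (Poly_Mapping.lookup f k))"
  by (rule poly_mapping_eqI)
    (simp add: lookup_sum lookup_single when_def in_keys_iff)

lemma scal_mult_sum:
  "scal c * f = (\<Sum>k\<in>Poly_Mapping.keys f. Poly_Mapping.single k (c * Poly_Mapping.lookup f k))"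
  by (subst free_alg_sum[of f])
    (simp add: sum_distrib_left scal_def mult_single plus_list_def)

lemma lookup_scal_mult [simp]:
  "Poly_Mapping.lookup (scal c * f) k = c * Poly_Mapping.lookup f k"
  by (simp add: scal_mult_sum lookup_sum lookup_single when_def in_keys_iff)

lemma scal_central: "f * scal c = scal c * f"
proof -
  have "f * scal c =
      (\<Sum>k\<in>Poly_Mapping.keys f. Poly_Mapping.single k (c * Poly_Mapping.lookup f k))"
    by (subst free_alg_sum[of f])
      (simp add: sum_distrib_right scal_def mult_single plus_list_def mult.commute)
  then show ?thesis by (simp only: scal_mult_sum)
qed

lemma scal_scal_mult: "scal c * (scal d * f) = scal (c * d) * f"
  by (rule poly_mapping_eqI) (simp add: mult.assoc)

lemma scal_0 [simp]: "scal 0 = 0"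
  by (simp add: scal_def)

lemma scal_1_mult [simp]: "scal 1 * f = f"
  by (rule poly_mapping_eqI) simp

lemma act_sum:
  "act (u, v) f =
    (\<Sum>k\<in>Poly_Mapping.keys f. Poly_Mapping.single (u @ k @ v) (Poly_Mapping.lookup f k))"
  by (subst free_alg_sum[of f])
    (simp add: sum_distrib_left sum_distrib_right mon_def mult_single plus_list_def)

lemma act_word_inj: "act_word \<tau> u = act_word \<tau> v \<longleftrightarrow> u = v"
  by (cases \<tau>) auto

lemma lookup_act: "Poly_Mapping.lookup (act \<tau> f) (act_word \<tau> w) = Poly_Mapping.lookup f w"
  by (cases \<tau>) (simp add: act_sum lookup_sum lookup_single when_def in_keys_iff del: act.simps)

lemma keys_act: "Poly_Mapping.keys (act \<tau> f) = act_word \<tau> ` Poly_Mapping.keys f"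
proof
  obtain u v where \<tau>: "\<tau> = (u, v)" by fastforce
  show "Poly_Mapping.keys (act \<tau> f) \<subseteq> act_word \<tau> ` Poly_Mapping.keys f"
    unfolding \<tau> act_sum by (rule order_trans[OF keys_sum]) (auto split: if_splits)
  show "act_word \<tau> ` Poly_Mapping.keys f \<subseteq> Poly_Mapping.keys (act \<tau> f)"
    by (auto simp: in_keys_iff lookup_act)
qed

lemma act_0 [simp]: "act \<tau> 0 = 0"
  by (cases \<tau>) simp

lemma act_add: "act \<tau> (f + g) = act \<tau> f + act \<tau> g"
  by (cases \<tau>) (simp add: algebra_simps)

lemma act_diff: "act \<tau> (f - g) = act \<tau> f - act \<tau> g"
  by (cases \<tau>) (simp add: algebra_simps)

lemma act_scal: "act \<tau> (scal c * f) = scal c * act \<tau> f"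
  by (cases \<tau>) (simp, metis mult.assoc scal_central)

lemma mon_append: "mon (u @ v) = mon u * mon v"
  by (simp add: mon_def mult_single plus_list_def)

text \<open>The product of the basis elements of the enveloping algebra: \<open>nest \<rho> \<tau>\<close> acts as \<open>\<tau>\<close>, then \<open>\<rho>\<close>.\<close>

fun nest :: "'x list \<times> 'x list \<Rightarrow> 'x list \<times> 'x list \<Rightarrow> 'x list \<times> 'x list"
  where "nest (p, q) (u, v) = (p @ u, v @ q)"

lemma act_nest: "act (nest \<rho> \<tau>) f = act \<rho> (act \<tau> f)"
  by (cases \<rho>; cases \<tau>) (simp add: mon_append mult.assoc)

lemma act_word_nest: "act_word (nest \<rho> \<tau>) u = act_word \<rho> (act_word \<tau> u)"
  by (cases \<rho>; cases \<tau>) simp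


section \<open>Combinations with prescribed leading words\<close>

text \<open>
  The set \<open>W\<close> restricts the leading words of the summands, not those of the sum: cancellation
  between summands is what has to be controlled. With \<open>W\<close> the words up to the leading word of
  the sum these are the standard representations.
\<close>

inductive_set lead_span ::
    "'x list rel \<Rightarrow> ('x, 'a::comm_ring_1) free_alg set \<Rightarrow> 'x list set \<Rightarrow> ('x, 'a) free_alg set"
  for r G W
  where
    zero: "0 \<in> lead_span r G W"
  | step: "g \<in> G \<Longrightarrow> act_word \<tau> (lm r g) \<in> W \<Longrightarrow> f \<in> lead_span r G W \<Longrightarrow>
      scal c * act \<tau> g + f \<in> lead_span r G W"

lemma lead_span_restrict:
  assumes "f \<in> lead_span r G W"
    and "\<And>g \<tau>. g \<in> G \<Longrightarrow> act_word \<tau> (lm r g) \<in> W \<Longrightarrow> act_word \<tau> (lm r g) \<in> V"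
  shows "f \<in> lead_span r G V"
  using assms(1) by (induction rule: lead_span.induct) (auto intro: lead_span.intros assms(2))

lemma lead_span_mono: "f \<in> lead_span r G W \<Longrightarrow> W \<subseteq> V \<Longrightarrow> f \<in> lead_span r G V"
  by (erule lead_span_restrict) blast

lemma lead_span_generator:
  "g \<in> G \<Longrightarrow> act_word \<tau> (lm r g) \<in> W \<Longrightarrow> scal c * act \<tau> g \<in> lead_span r G W"
  using lead_span.step[OF _ _ lead_span.zero, of g G \<tau> r W c] by simp

lemma lead_span_add:
  "f \<in> lead_span r G W \<Longrightarrow> h \<in> lead_span r G W \<Longrightarrow> f + h \<in> lead_span r G W"
  by (induction rule: lead_span.induct) (auto simp: add.assoc intro: lead_span.intros)

lemma lead_span_scal: "f \<in> lead_span r G W \<Longrightarrow> scal c * f \<in> lead_span r G W"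
  by (induction rule: lead_span.induct)
    (auto simp: distrib_left scal_scal_mult intro: lead_span.intros)

lemma lead_span_uminus:
  assumes "f \<in> lead_span r G W"
  shows "- f \<in> lead_span r G W"
proof -
  have "- f = scal (- 1) * f" by (rule poly_mapping_eqI) simp
  then show ?thesis using lead_span_scal[OF assms] by simp
qed

text \<open>
  Carries a representation from a minimal overlap to a larger word that contains it.
\<close>

lemma lead_span_act:
  assumes "f \<in> lead_span r G W" "act_word \<rho> ` W \<subseteq> V"
  shows "act \<rho> f \<in> lead_span r G V"
  using assms(1)
proof (induction rule: lead_span.induct)
  case (step g \<tau> f c)
  then have "act_word (nest \<rho> \<tau>) (lm r g) \<in> V"
    using assms(2) by (auto simp: act_word_nest)
  then show ?case
    using step lead_span.step[of g G "nest \<rho> \<tau>" r V "act \<rho> f" c]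
    by (simp add: act_add act_scal act_nest)
qed (simp add: lead_span.zero)

lemma lead_span_sum:
  "(\<And>i. i \<in> A \<Longrightarrow> f i \<in> lead_span r G W) \<Longrightarrow> sum f A \<in> lead_span r G W"
  by (induction A rule: infinite_finite_induct) (auto intro: lead_span.zero lead_span_add)

lemma two_sided_ideal_lead_span: "two_sided_ideal (lead_span r G UNIV)"
proof -
  have word: "act \<rho> f \<in> lead_span r G UNIV" if "f \<in> lead_span r G UNIV" for \<rho> f
    using lead_span_act[OF that] by blast
  have "p * f \<in> lead_span r G UNIV \<and> f * p \<in> lead_span r G UNIV"
    if f: "f \<in> lead_span r G UNIV" for p f
  proof -
    have left: "Poly_Mapping.single u c * f = scal c * act (u, []) f" for u c
      by (simp add: single_eq_scal_mon mult.assoc) (simp add: mon_def zero_list_def[symmetric])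
    have right: "f * Poly_Mapping.single u c = scal c * act ([], u) f" for u c
    proof -
      have "f * Poly_Mapping.single u c = scal c * (f * mon u)"
        unfolding single_eq_scal_mon by (metis mult.assoc scal_central)
      then show ?thesis by (simp add: mon_def zero_list_def[symmetric])
    qed
    have "p * f = (\<Sum>k\<in>Poly_Mapping.keys p.
        scal (Poly_Mapping.lookup p k) * act (k, []) f)"
      by (subst free_alg_sum[of p]) (simp only: sum_distrib_right left)
    moreover have "f * p = (\<Sum>k\<in>Poly_Mapping.keys p.
        scal (Poly_Mapping.lookup p k) * act ([], k) f)"
      by (subst free_alg_sum[of p]) (simp only: sum_distrib_left right)
    ultimately show ?thesis
      by (auto intro!: lead_span_sum lead_span_scal word[OF f] simp del: act.simps)
  qed
  then show ?thesis
    by (auto simp: two_sided_ideal_def intro: lead_span.zero lead_span_add)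
qed

lemma ideal_gen_subset_lead_span: "ideal_gen G \<subseteq> lead_span r G UNIV"
proof (rule hull_minimal)
  show "G \<subseteq> lead_span r G UNIV"
  proof
    fix g assume "g \<in> G"
    then have "scal 1 * act ([], []) g \<in> lead_span r G UNIV"
      by (rule lead_span_generator) simp
    then show "g \<in> lead_span r G UNIV"
      by (simp add: mon_def zero_list_def[symmetric])
  qed
qed (rule two_sided_ideal_lead_span)

lemma two_sided_ideal_ideal_gen: "two_sided_ideal (ideal_gen G)"
  by (rule hull_in) (simp add: two_sided_ideal_def)

lemma ideal_gen_add: "f \<in> ideal_gen G \<Longrightarrow> g \<in> ideal_gen G \<Longrightarrow> f + g \<in> ideal_gen G"
  using two_sided_ideal_ideal_gen[of G] by (simp add: two_sided_ideal_def)

lemma ideal_gen_mult_left: "f \<in> ideal_gen G \<Longrightarrow> p * f \<in> ideal_gen G"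
  using two_sided_ideal_ideal_gen[of G] by (simp add: two_sided_ideal_def)

lemma ideal_gen_mult_right: "f \<in> ideal_gen G \<Longrightarrow> f * p \<in> ideal_gen G"
  using two_sided_ideal_ideal_gen[of G] by (simp add: two_sided_ideal_def)

lemma ideal_gen_diff: "f \<in> ideal_gen G \<Longrightarrow> g \<in> ideal_gen G \<Longrightarrow> f - g \<in> ideal_gen G"
  using ideal_gen_add[of f G "- 1 * g"] ideal_gen_mult_left[of g G "- 1"] by simp

lemma ideal_gen_scal_act: "f \<in> ideal_gen G \<Longrightarrow> scal c * act \<tau> f \<in> ideal_gen G"
  by (cases \<tau>) (simp add: ideal_gen_mult_left ideal_gen_mult_right)


section \<open>Leading words and coefficients\<close>

locale word_order =
  fixes r :: "'x list rel"
  assumes monomial_order: "monomial_well_order r"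
begin

lemma refl [simp]: "(u, u) \<in> r"
  using monomial_order
  by (auto simp: monomial_well_order_def well_order_on_def linear_order_on_def
      partial_order_on_def preorder_on_def refl_on_def)

lemma trans: "(u, v) \<in> r \<Longrightarrow> (v, w) \<in> r \<Longrightarrow> (u, w) \<in> r"
  using monomial_order
  by (auto simp: monomial_well_order_def well_order_on_def linear_order_on_def
      partial_order_on_def preorder_on_def elim: transE)

lemma antisym: "(u, v) \<in> r \<Longrightarrow> (v, u) \<in> r \<Longrightarrow> u = v"
  using monomial_order
  by (auto simp: monomial_well_order_def well_order_on_def linear_order_on_def
      partial_order_on_def antisym_def)

lemma total: "(u, v) \<in> r \<or> (v, u) \<in> r"
  using monomial_order refl
  by (cases "u = v") (auto simp: monomial_well_order_def well_order_on_def linear_order_on_def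
      total_on_def)

lemma wf: "wf (r - Id)"
  using monomial_order by (auto simp: monomial_well_order_def well_order_on_def)

lemma act_word_mono: "(u, v) \<in> r \<Longrightarrow> (act_word \<tau> u, act_word \<tau> v) \<in> r"
  using monomial_order by (cases \<tau>) (auto simp: monomial_well_order_def)

lemma underS_trans: "(u, v) \<in> r \<Longrightarrow> v \<in> underS r M \<Longrightarrow> u \<in> underS r M"
  by (auto simp: underS_def intro: trans dest: antisym)

lemma finite_maximum:
  "finite A \<Longrightarrow> A \<noteq> {} \<Longrightarrow> \<exists>M\<in>A. A \<subseteq> under r M"
proof (induction A rule: finite_ne_induct)
  case (insert x A)
  then obtain M where "M \<in> A" "A \<subseteq> under r M" by blast
  then show ?case using total[of x M] by (auto simp: under_def intro: trans)
qed (simp add: under_def)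

lemma lmI:
  assumes "Poly_Mapping.lookup f u \<noteq> 0" "Poly_Mapping.keys f \<subseteq> under r u"
  shows "lm r f = u"
  unfolding lm_def using assms
  by (intro the_equality) (auto simp: under_def in_keys_iff subset_iff intro!: antisym)

lemma
  assumes "f \<noteq> 0"
  shows lc_nonzero: "lc r f \<noteq> 0"
    and keys_under_lm: "Poly_Mapping.keys f \<subseteq> under r (lm r f)"
proof -
  obtain M where "M \<in> Poly_Mapping.keys f" "Poly_Mapping.keys f \<subseteq> under r M"
    using finite_maximum[of "Poly_Mapping.keys f"] assms by auto
  moreover from this have "lm r f = M"
    by (intro lmI) (auto simp: in_keys_iff)
  ultimately show "lc r f \<noteq> 0" "Poly_Mapping.keys f \<subseteq> under r (lm r f)"
    by (auto simp: lc_def in_keys_iff)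
qed

lemma lm_in_keys: "f \<noteq> 0 \<Longrightarrow> lm r f \<in> Poly_Mapping.keys f"
  using lc_nonzero by (auto simp: lc_def in_keys_iff)

lemma keys_act_under:
  "f \<noteq> 0 \<Longrightarrow> Poly_Mapping.keys (act \<tau> f) \<subseteq> under r (act_word \<tau> (lm r f))"
  using keys_under_lm[of f] by (auto simp: keys_act under_def intro: act_word_mono)

lemma keys_scal_act_under:
  "f \<noteq> 0 \<Longrightarrow> Poly_Mapping.keys (scal c * act \<tau> f) \<subseteq> under r (act_word \<tau> (lm r f))"
  using keys_act_under[of f \<tau>] by (fastforce simp: in_keys_iff)

lemma lookup_scal_act_lm:
  "Poly_Mapping.lookup (scal c * act \<tau> f) (act_word \<tau> (lm r f)) = c * lc r f"
  by (simp add: lookup_act lc_def)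

lemma keys_underS_if_cancel:
  "Poly_Mapping.keys f \<subseteq> under r M \<Longrightarrow> Poly_Mapping.lookup f M = 0 \<Longrightarrow>
    Poly_Mapping.keys f \<subseteq> underS r M"
  by (auto simp: under_def underS_def in_keys_iff)

lemma keys_lead_span:
  assumes "0 \<notin> G" "f \<in> lead_span r G W" "v \<in> Poly_Mapping.keys f"
  shows "\<exists>u\<in>W. (v, u) \<in> r"
  using assms(2,3)
proof (induction arbitrary: v rule: lead_span.induct)
  case (step g \<tau> f c)
  then have "g \<noteq> 0" using assms(1) by auto
  moreover have "v \<in> Poly_Mapping.keys (scal c * act \<tau> g) \<or> v \<in> Poly_Mapping.keys f"
    using subsetD[OF keys_add step.prems] by blast
  ultimately show ?case
    using step keys_scal_act_under[of g c \<tau>] by (auto simp: under_def)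
qed simp

text \<open>
  A representation has finitely many summands, so the order has a largest leading word among
  them. This starts the descent on \<open>M\<close> (with \<open>W = UNIV\<close>) and continues it (with \<open>W\<close> the
  words strictly below \<open>M\<close>).
\<close>

lemma lead_span_bounded:
  assumes "f \<in> lead_span r G W"
  shows "f = 0 \<or> (\<exists>M\<in>W. f \<in> lead_span r G (under r M))"
  using assms
proof (induction rule: lead_span.induct)
  case (step g \<tau> f c)
  let ?u = "act_word \<tau> (lm r g)"
  obtain M where M: "M \<in> W" "(?u, M) \<in> r" "f \<in> lead_span r G (under r M)"
  proof (cases "f = 0")
    case True
    then show ?thesis using step that[of ?u] by (simp add: lead_span.zero)
  next
    case False
    then obtain M where M: "M \<in> W" "f \<in> lead_span r G (under r M)" using step by blast
    show ?thesis
    proof (cases "(?u, M) \<in> r")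
      case True
      then show ?thesis using M that by blast
    next
      case False
      then have "under r M \<subseteq> under r ?u" using total[of ?u M] by (auto simp: under_def intro: trans)
      then show ?thesis using M step that[of ?u] by (auto intro: lead_span_mono)
    qed
  qed
  then show ?case using step by (auto simp: under_def intro: lead_span.step)
qed simp


section \<open>What a reduction to zero provides\<close>

text \<open>
  The remainder \<open>b\<close> of the coefficient division is the coefficient of the reduced polynomial at
  the old leading word; a zero coefficient means that the leading word has been removed.
\<close>

lemma lm_reduction_props:
  assumes "lm_reduction r g f h"
  obtains \<tau> a where "g \<noteq> 0" "f \<noteq> 0" "a \<noteq> 0" "lm r f = act_word \<tau> (lm r g)"
    "f = scal a * act \<tau> g + h"
    "lc r f = a * lc r g + Poly_Mapping.lookup h (lm r f)"
    "euclidean_size (Poly_Mapping.lookup h (lm r f)) < euclidean_size (lc r f)"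
    "Poly_Mapping.keys h \<subseteq> under r (lm r f)"
proof -
  obtain \<tau> a b where *: "g \<noteq> 0" "f \<noteq> 0" "lm r f = act_word \<tau> (lm r g)" "a \<noteq> 0"
      "euclidean_size b < euclidean_size (lc r f)" "lc r f = a * lc r g + b"
      "h = f - scal a * act \<tau> g"
    using assms unfolding lm_reduction_def by blast
  have lookup: "Poly_Mapping.lookup h (lm r f) = b"
    using * lookup_scal_act_lm[of a \<tau> g] by (simp add: lookup_minus lc_def)
  have keys: "Poly_Mapping.keys h \<subseteq> under r (lm r f)"
    using keys_diff[of f "scal a * act \<tau> g"] keys_under_lm[OF *(2)] keys_scal_act_under[OF *(1)] *(3,7)
    by fastforce
  show ?thesis
  proof (rule that[OF *(1,2,4,3)])
    show "f = scal a * act \<tau> g + h" using *(7) by simp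
  qed (use *(5,6) lookup keys in simp_all)
qed

text \<open>Leading words never increase along a reduction, so the subtracted multiples add up to \<open>f\<close>.\<close>

lemma reduces_to_zero_lead_span:
  assumes "reduces_to_zero r G f"
  shows "f \<in> lead_span r G (under r (lm r f))"
  using assms unfolding reduces_to_zero_def
proof (induction rule: converse_rtranclp_induct)
  case (step f h)
  then obtain g where g: "g \<in> G" "lm_reduction r g f h" by blast
  from g(2) obtain \<tau> a where *: "lm r f = act_word \<tau> (lm r g)"
      "f = scal a * act \<tau> g + h" "Poly_Mapping.keys h \<subseteq> under r (lm r f)"
    by (rule lm_reduction_props)
  have "h \<in> lead_span r G (under r (lm r f))"
  proof (cases "h = 0")
    case False
    then have "(lm r h, lm r f) \<in> r" using *(3) lm_in_keys by (auto simp: under_def)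
    then have "under r (lm r h) \<subseteq> under r (lm r f)" by (auto simp: under_def intro: trans)
    then show ?thesis using step.IH lead_span_mono by blast
  qed (simp add: lead_span.zero)
  then have "scal a * act \<tau> g + h \<in> lead_span r G (under r (lm r f))"
    using g(1) *(1) by (intro lead_span.step) (simp_all add: under_def)
  then show ?case using *(2) by simp
qed (rule lead_span.zero)

text \<open>
  As long as a nonzero remainder is left, the leading word stays and the size of the leading
  coefficient drops. The element wanted is the one that finally removes the leading word: its
  leading coefficient divides the current one.
\<close>

lemma reduces_to_zero_small_lc:
  assumes "reduces_to_zero r G f" "f \<noteq> 0"
  shows "\<exists>g\<in>G. word_dvd (lm r g) (lm r f) \<and> euclidean_size (lc r g) \<le> euclidean_size (lc r f)"
  using assms unfolding reduces_to_zero_def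
proof (induction rule: converse_rtranclp_induct)
  case (step f h)
  then obtain g where g: "g \<in> G" "lm_reduction r g f h" by blast
  from g(2) obtain \<tau> a where *: "g \<noteq> 0" "f \<noteq> 0" "a \<noteq> 0" "lm r f = act_word \<tau> (lm r g)"
      "lc r f = a * lc r g + Poly_Mapping.lookup h (lm r f)"
      "euclidean_size (Poly_Mapping.lookup h (lm r f)) < euclidean_size (lc r f)"
      "Poly_Mapping.keys h \<subseteq> under r (lm r f)"
    by (rule lm_reduction_props)
  show ?case
  proof (cases "Poly_Mapping.lookup h (lm r f) = 0")
    case True
    then have "euclidean_size (lc r g) \<le> euclidean_size (lc r f)"
      using *(3,5) size_mult_mono[of a "lc r g"] by (simp add: mult.commute)
    then show ?thesis using g(1) *(4) unfolding word_dvd_def by blast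
  next
    case False
    then have "lm r h = lm r f" using *(7) by (rule lmI)
    moreover have "h \<noteq> 0" using False by auto
    moreover have "euclidean_size (lc r h) < euclidean_size (lc r f)"
      using *(6) calculation(1) by (simp add: lc_def)
    ultimately show ?thesis using step.IH by (metis less_imp_le order_trans)
  qed
qed simp


section \<open>Two occurrences in one word\<close>

definition sg_polys_reduce ::
    "('a::euclidean_ring_gcd \<Rightarrow> 'a \<Rightarrow> 'a \<times> 'a) \<Rightarrow> ('x, 'a) free_alg set \<Rightarrow> bool"
  where "sg_polys_reduce bez G \<longleftrightarrow> (\<forall>f\<in>G. \<forall>g\<in>G.
      (\<forall>t\<in>LCM_words (lm r f) (lm r g). \<forall>\<tau>f \<tau>g.
        act_word \<tau>f (lm r f) = t \<and> act_word \<tau>g (lm r g) = t \<longrightarrow>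
          reduces_to_zero r G (spoly1 r \<tau>f \<tau>g f g) \<and>
          reduces_to_zero r G (gpoly1 r bez \<tau>f \<tau>g f g)) \<and>
      (\<forall>w. reduces_to_zero r G (spoly2 r w f g) \<and>
           reduces_to_zero r G (gpoly2 r bez w f g)))"

text \<open>
  A polynomial of the second type is one of the first type for the word \<open>lm f w lm g\<close>, which is
  not an overlap; this allows both types to be treated alike.
\<close>

lemma spoly2_eq_spoly1: "spoly2 r w f g = spoly1 r ([], w @ lm r g) (lm r f @ w, []) f g"
  by (simp add: spoly2_def spoly1_def mon_append mult.assoc)
    (simp add: mon_def zero_list_def[symmetric])

lemma gpoly2_eq_gpoly1:
  "gpoly2 r bez w f g = gpoly1 r bez ([], w @ lm r g) (lm r f @ w, []) f g"
  by (simp add: gpoly2_def gpoly1_def mon_append mult.assoc)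
    (simp add: mon_def zero_list_def[symmetric])

end

text \<open>
  Let \<open>s\<close> be the word from the start of \<open>u\<close> to the start of \<open>v\<close>. Comparing lengths, either \<open>u\<close>
  ends no later than \<open>v\<close> starts, or \<open>v\<close> lies inside \<open>u\<close>, or a final piece of \<open>u\<close> overlaps an initial
  piece of \<open>v\<close>. The common context is whatever lies outside both occurrences.
\<close>

lemma occurrences_ordered:
  assumes "act_word (p, q) u = act_word (p', q') v" "length p \<le> length p'"
  shows "(\<exists>w. (p, q) = nest (p, q') ([], w @ v) \<and> (p', q') = nest (p, q') (u @ w, [])) \<or>
    (\<exists>\<rho> \<sigma> \<sigma>'. (p, q) = nest \<rho> \<sigma> \<and> (p', q') = nest \<rho> \<sigma>' \<and>
      act_word \<sigma> u = act_word \<sigma>' v \<and> act_word \<sigma> u \<in> LCM_words u v)"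
proof -
  have split: "\<exists>e. ys = xs @ e \<and> zs = e @ ws"
    if "xs @ zs = ys @ ws" "length xs \<le> length ys" for xs ys zs ws :: "'a list"
    using that by (auto simp: append_eq_append_conv2)
  obtain s where s: "p' = p @ s" "u @ q = s @ v @ q'"
    using split[of p "u @ q" p' "v @ q'"] assms by auto
  consider w where "s = u @ w" | "length s < length u" "length s + length v \<le> length u"
    | "length s < length u" "length u < length s + length v"
  proof (cases "length u \<le> length s")
    case True
    then show ?thesis using split[OF s(2)] that by blast
  qed (use that in linarith)
  then show ?thesis
  proof cases
    case 1
    then show ?thesis using s by auto
  next
    case 2
    obtain e where e: "u = s @ v @ e" "q' = e @ q"
      using split[of "s @ v" q' u q] 2 s(2) by auto
    have "u \<in> LCM_words u v" using e by (auto simp: LCM_words_def)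
    then show ?thesis using e s
      by (intro disjI2 exI[of _ "(p, q)"] exI[of _ "([], [])"] exI[of _ "(s, e)"]) auto
  next
    case 3
    obtain e where e: "s @ v = u @ e" "q = e @ q'"
      using split[of u q "s @ v" q'] 3 s(2) by auto
    have "length s + length v = length u + length e"
      using arg_cong[OF e(1), of length] by simp
    then have "length e < length v" using 3 by simp
    then have "u @ e \<in> LCM_words u v"
      unfolding LCM_words_def using e(1) 3
      by (intro CollectI exI[of _ e] exI[of _ s] disjI1) simp
    then show ?thesis using e s
      by (intro disjI2 exI[of _ "(p, q')"] exI[of _ "([], e)"] exI[of _ "(s, [])"]) auto
  qed
qed

context word_order
begin

text \<open>
  For any two ways to reach one word from \<open>lm f\<close> and \<open>lm g\<close>, stripping the common context \<open>\<rho>\<close>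
  leaves a pair that the hypothesis speaks of.
\<close>

lemma common_multiple_reduces:
  assumes "sg_polys_reduce bez G" "f \<in> G" "g \<in> G"
    and "act_word (p, q) (lm r f) = act_word (p', q') (lm r g)" "length p \<le> length p'"
  shows "\<exists>\<rho> \<sigma> \<sigma>'. (p, q) = nest \<rho> \<sigma> \<and> (p', q') = nest \<rho> \<sigma>' \<and>
    act_word \<sigma> (lm r f) = act_word \<sigma>' (lm r g) \<and>
    reduces_to_zero r G (spoly1 r \<sigma> \<sigma>' f g) \<and>
    reduces_to_zero r G (gpoly1 r bez \<sigma> \<sigma>' f g)"
  using occurrences_ordered[OF assms(4,5)]
proof (elim disjE exE conjE)
  fix w
  assume w: "(p, q) = nest (p, q') ([], w @ lm r g)" "(p', q') = nest (p, q') (lm r f @ w, [])"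
  have "reduces_to_zero r G (spoly2 r w f g)" "reduces_to_zero r G (gpoly2 r bez w f g)"
    using assms(1)[unfolded sg_polys_reduce_def, rule_format, OF assms(2,3)] by simp_all
  then have "act_word ([], w @ lm r g) (lm r f) = act_word (lm r f @ w, []) (lm r g) \<and>
      reduces_to_zero r G (spoly1 r ([], w @ lm r g) (lm r f @ w, []) f g) \<and>
      reduces_to_zero r G (gpoly1 r bez ([], w @ lm r g) (lm r f @ w, []) f g)"
    by (simp add: spoly2_eq_spoly1 gpoly2_eq_gpoly1)
  with w show ?thesis
    by (intro exI[of _ "(p, q')"] exI[of _ "([], w @ lm r g)"] exI[of _ "(lm r f @ w, [])"] conjI)
      simp_all
next
  fix \<rho> \<sigma> \<sigma>'
  assume *: "(p, q) = nest \<rho> \<sigma>" "(p', q') = nest \<rho> \<sigma>'"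
    "act_word \<sigma> (lm r f) = act_word \<sigma>' (lm r g)"
    "act_word \<sigma> (lm r f) \<in> LCM_words (lm r f) (lm r g)"
  then have "reduces_to_zero r G (spoly1 r \<sigma> \<sigma>' f g) \<and>
      reduces_to_zero r G (gpoly1 r bez \<sigma> \<sigma>' f g)"
    using assms(1)[unfolded sg_polys_reduce_def, rule_format, OF assms(2,3)] by (simp del: split_paired_All)
  with * show ?thesis
    by (intro exI[of _ \<rho>] exI[of _ \<sigma>] exI[of _ \<sigma>'] conjI) simp_all
qed

lemma spoly1_cancel:
  assumes "f \<noteq> 0" "g \<noteq> 0" "act_word \<sigma> (lm r f) = act_word \<sigma>' (lm r g)"
  shows "Poly_Mapping.keys (spoly1 r \<sigma> \<sigma>' f g) \<subseteq> underS r (act_word \<sigma> (lm r f))"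
proof (rule keys_underS_if_cancel)
  show "Poly_Mapping.keys (spoly1 r \<sigma> \<sigma>' f g) \<subseteq> under r (act_word \<sigma> (lm r f))"
    unfolding spoly1_def
    using keys_scal_act_under[OF assms(1), of _ \<sigma>] keys_scal_act_under[OF assms(2), of _ \<sigma>'] assms(3)
    by (intro order_trans[OF keys_diff] Un_least) simp_all
  show "Poly_Mapping.lookup (spoly1 r \<sigma> \<sigma>' f g) (act_word \<sigma> (lm r f)) = 0"
    using lookup_scal_act_lm[of "cofactor1 r f g" \<sigma> f] lookup_scal_act_lm[of "cofactor2 r f g" \<sigma>' g]
      assms(3)
    by (simp add: spoly1_def lookup_minus cofactor1_def cofactor2_def)
qed

lemma spoly1_swap: "spoly1 r \<sigma>' \<sigma> g f = - spoly1 r \<sigma> \<sigma>' f g"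
  by (simp add: spoly1_def cofactor1_def cofactor2_def lcm.commute)

lemma spoly1_nest: "spoly1 r (nest \<rho> \<sigma>) (nest \<rho> \<sigma>') f g = act \<rho> (spoly1 r \<sigma> \<sigma>' f g)"
  by (simp add: spoly1_def act_nest act_diff act_scal)

text \<open>
  The defining property of S-polynomials, cancellation of the leading terms, gives a
  representation strictly below \<open>M\<close> once the S-polynomial reduces to zero. If the occurrence of
  \<open>lm g\<close> comes first, the S-polynomial of the exchanged pair, which is the negative, serves.
\<close>

lemma spoly1_lower:
  assumes "sg_polys_reduce bez G" "0 \<notin> G" "f \<in> G" "g \<in> G"
    and "act_word \<tau> (lm r f) = M" "act_word \<tau>' (lm r g) = M"
  shows "spoly1 r \<tau> \<tau>' f g \<in> lead_span r G (underS r M)"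
proof -
  have ordered: "spoly1 r (p, q) (p', q') f g \<in> lead_span r G (underS r M)"
    if fg: "f \<in> G" "g \<in> G" "act_word (p, q) (lm r f) = M" "act_word (p', q') (lm r g) = M"
      and "length p \<le> length p'" for p q p' q' f g
  proof -
    from that obtain \<rho> \<sigma> \<sigma>' where *: "(p, q) = nest \<rho> \<sigma>" "(p', q') = nest \<rho> \<sigma>'"
      "act_word \<sigma> (lm r f) = act_word \<sigma>' (lm r g)"
      "reduces_to_zero r G (spoly1 r \<sigma> \<sigma>' f g)"
      using common_multiple_reduces[OF assms(1), of f g p q p' q'] by metis
    let ?s = "spoly1 r \<sigma> \<sigma>' f g"
    have M: "M = act_word \<rho> (act_word \<sigma> (lm r f))" using fg(3) *(1) act_word_nest by metis
    have "act \<rho> ?s \<in> lead_span r G (underS r M)"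
    proof (cases "?s = 0")
      case False
      have "lm r ?s \<in> underS r (act_word \<sigma> (lm r f))"
        using spoly1_cancel[OF _ _ *(3)] lm_in_keys[OF False] fg(1,2) assms(2) by blast
      then have "under r (lm r ?s) \<subseteq> underS r (act_word \<sigma> (lm r f))"
        using underS_trans by (auto simp: under_def)
      then have "act_word \<rho> ` under r (lm r ?s) \<subseteq> underS r M"
        by (auto simp: M underS_def act_word_inj intro!: act_word_mono)
      then show ?thesis by (rule lead_span_act[OF reduces_to_zero_lead_span[OF *(4)]])
    qed (simp add: lead_span.zero)
    then show ?thesis by (simp only: *(1,2) spoly1_nest)
  qed
  obtain p q p' q' where \<tau>: "\<tau> = (p, q)" "\<tau>' = (p', q')" by fastforce
  show ?thesis
  proof (cases "length p \<le> length p'")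
    case True
    then show ?thesis using ordered assms(3-6) unfolding \<tau> by blast
  next
    case False
    then have "spoly1 r \<tau>' \<tau> g f \<in> lead_span r G (underS r M)"
      using ordered assms(3-6) unfolding \<tau> by simp
    then show ?thesis using lead_span_uminus spoly1_swap by (metis add.inverse_inverse)
  qed
qed

text \<open>
  By the choice of the Bezout coefficients the leading coefficients combine to their gcd, which
  is nonzero, so the common leading word survives.
\<close>

lemma gpoly1_lead:
  assumes "bezout_function bez" "f \<noteq> 0" "g \<noteq> 0" "act_word \<sigma> (lm r f) = act_word \<sigma>' (lm r g)"
  shows "gpoly1 r bez \<sigma> \<sigma>' f g \<noteq> 0"
    and "lm r (gpoly1 r bez \<sigma> \<sigma>' f g) = act_word \<sigma> (lm r f)"
    and "lc r (gpoly1 r bez \<sigma> \<sigma>' f g) = gcd (lc r f) (lc r g)"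
proof -
  let ?h = "gpoly1 r bez \<sigma> \<sigma>' f g" and ?t = "act_word \<sigma> (lm r f)"
  have "Poly_Mapping.lookup ?h ?t = gcd (lc r f) (lc r g)"
    using lookup_scal_act_lm[of 1 \<sigma> f] lookup_scal_act_lm[of 1 \<sigma>' g] assms(1,4)
    by (simp add: gpoly1_def lookup_add bezout_function_def)
  moreover have "gcd (lc r f) (lc r g) \<noteq> 0" using lc_nonzero assms(2) by auto
  moreover have "Poly_Mapping.keys ?h \<subseteq> under r ?t"
    unfolding gpoly1_def
    using keys_scal_act_under[OF assms(2), of _ \<sigma>] keys_scal_act_under[OF assms(3), of _ \<sigma>'] assms(4)
    by (intro order_trans[OF keys_add] Un_least) simp_all
  ultimately show "?h \<noteq> 0" "lm r ?h = ?t" "lc r ?h = gcd (lc r f) (lc r g)"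
    using lmI[of ?h ?t] by (auto simp: lc_def)
qed

text \<open>
  The G-polynomial of \<open>f\<close> and \<open>g\<close> with the common context stripped reduces to zero, and a divisor
  of its leading word divides \<open>M\<close> as well. The bound is symmetric in \<open>f\<close> and \<open>g\<close>, although the
  Bezout coefficients need not be.
\<close>

lemma gcd_bound:
  assumes "sg_polys_reduce bez G" "bezout_function bez" "0 \<notin> G" "f \<in> G" "g \<in> G"
    and "act_word \<tau> (lm r f) = M" "act_word \<tau>' (lm r g) = M"
  shows "\<exists>h\<in>G. word_dvd (lm r h) M \<and>
    euclidean_size (lc r h) \<le> euclidean_size (gcd (lc r f) (lc r g))"
proof -
  have ordered: "\<exists>h\<in>G. word_dvd (lm r h) M \<and>
      euclidean_size (lc r h) \<le> euclidean_size (gcd (lc r f) (lc r g))"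
    if fg: "f \<in> G" "g \<in> G" "act_word (p, q) (lm r f) = M" "act_word (p', q') (lm r g) = M"
      and "length p \<le> length p'" for p q p' q' f g
  proof -
    from that obtain \<rho> \<sigma> \<sigma>' where *: "(p, q) = nest \<rho> \<sigma>"
      "act_word \<sigma> (lm r f) = act_word \<sigma>' (lm r g)"
      "reduces_to_zero r G (gpoly1 r bez \<sigma> \<sigma>' f g)"
      using common_multiple_reduces[OF assms(1), of f g p q p' q'] by metis
    have M: "M = act_word \<rho> (act_word \<sigma> (lm r f))" using fg(3) *(1) act_word_nest by metis
    have "f \<noteq> 0" "g \<noteq> 0" using fg assms(3) by auto
    note lead = gpoly1_lead[OF assms(2) this *(2)]
    obtain h where h: "h \<in> G" "word_dvd (lm r h) (act_word \<sigma> (lm r f))"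
        "euclidean_size (lc r h) \<le> euclidean_size (gcd (lc r f) (lc r g))"
      using reduces_to_zero_small_lc[OF *(3) lead(1)] unfolding lead(2,3) by blast
    then have "word_dvd (lm r h) M"
      unfolding word_dvd_def M by (metis act_word_nest)
    with h show ?thesis by blast
  qed
  obtain p q p' q' where "\<tau> = (p, q)" "\<tau>' = (p', q')" by fastforce
  then show ?thesis
    using ordered[of f g p q p' q'] ordered[of g f p' q' p q] assms(4-7)
    by (cases "length p \<le> length p'") (auto simp: gcd.commute)
qed

text \<open>
  A proper divisor has smaller Euclidean size, so an element whose leading coefficient has least
  size cannot have a proper gcd with another one.
\<close>

lemma dividing_generator:
  assumes "sg_polys_reduce bez G" "bezout_function bez" "0 \<notin> G" "g \<in> G" "word_dvd (lm r g) M"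
  shows "\<exists>d\<in>G. word_dvd (lm r d) M \<and>
    (\<forall>f\<in>G. word_dvd (lm r f) M \<longrightarrow> lc r d dvd lc r f)"
proof -
  obtain d where d: "d \<in> G" "word_dvd (lm r d) M"
    "\<And>f. f \<in> G \<Longrightarrow> word_dvd (lm r f) M \<Longrightarrow> euclidean_size (lc r d) \<le> euclidean_size (lc r f)"
    using ex_has_least_nat[of "\<lambda>f. f \<in> G \<and> word_dvd (lm r f) M" g "\<lambda>f. euclidean_size (lc r f)"]
      assms(4,5) by blast
  have "lc r d dvd lc r f" if f: "f \<in> G" "word_dvd (lm r f) M" for f
  proof (rule ccontr)
    assume "\<not> lc r d dvd lc r f"
    then have "\<not> lc r d dvd gcd (lc r d) (lc r f)" by simp
    moreover have "lc r d \<noteq> 0" using d(1) assms(3) by (metis lc_nonzero)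
    ultimately have "euclidean_size (gcd (lc r d) (lc r f)) < euclidean_size (lc r d)"
      by (intro dvd_proper_imp_size_less) auto
    moreover obtain h where "h \<in> G" "word_dvd (lm r h) M"
        "euclidean_size (lc r h) \<le> euclidean_size (gcd (lc r d) (lc r f))"
      using gcd_bound[OF assms(1-3) d(1) f(1)] d(2) f(2) unfolding word_dvd_def by metis
    ultimately show False using d(3) by fastforce
  qed
  then show ?thesis using d(1,2) by blast
qed

text \<open>
  When \<open>lc d\<close> divides \<open>lc f\<close>, their lcm is associated to \<open>lc f\<close>. It need not equal \<open>lc f\<close>,
  because lcms are normalized; so the S-polynomial is multiplied by the inverse of the unit
  \<open>lcm (lc f) (lc d) div lc f\<close>.
\<close>

lemma generator_rewrite:
  assumes "sg_polys_reduce bez G" "0 \<notin> G" "f \<in> G" "d \<in> G"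
    and "act_word \<tau> (lm r f) = M" "act_word \<delta> (lm r d) = M" "lc r d dvd lc r f"
  shows "\<exists>a. scal c * act \<tau> f - scal a * act \<delta> d \<in> lead_span r G (underS r M)"
proof -
  let ?e = "cofactor1 r f d"
  have "lc r f \<noteq> 0" using assms(2,3) by (metis lc_nonzero)
  moreover have "lcm (lc r f) (lc r d) = normalize (lc r f)"
    using assms(7) by (simp add: lcm_proj1_iff)
  ultimately have "is_unit ?e"
    unfolding cofactor1_def by (simp add: dvd_div_iff_mult div_dvd_iff_mult)
  then obtain e' where e': "e' * ?e = 1" by (metis dvd_def mult.commute)
  have "scal (c * e') * spoly1 r \<tau> \<delta> f d \<in> lead_span r G (underS r M)"
    by (rule lead_span_scal[OF spoly1_lower[OF assms(1-6)]])
  moreover have "scal (c * e') * spoly1 r \<tau> \<delta> f d =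
      scal c * act \<tau> f - scal (c * e' * cofactor2 r f d) * act \<delta> d"
    using e' by (simp add: spoly1_def right_diff_distrib scal_scal_mult mult.assoc)
  ultimately show ?thesis by auto
qed

text \<open>
  Every summand with leading word \<open>M\<close> is exchanged for a multiple of the same \<open>\<delta> d\<close>; the
  multiples add up to a single one, in which no further cancellation can occur.
\<close>

lemma lead_span_top:
  assumes "sg_polys_reduce bez G" "0 \<notin> G" "d \<in> G" "act_word \<delta> (lm r d) = M"
    and "\<And>f. f \<in> G \<Longrightarrow> word_dvd (lm r f) M \<Longrightarrow> lc r d dvd lc r f"
    and "f \<in> lead_span r G (under r M)"
  shows "\<exists>c. f - scal c * act \<delta> d \<in> lead_span r G (underS r M)"
  using assms(6)
proof (induction rule: lead_span.induct)
  case zero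
  show ?case by (rule exI[of _ 0]) (simp add: lead_span.zero)
next
  case (step g \<tau> f b)
  then obtain c where c: "f - scal c * act \<delta> d \<in> lead_span r G (underS r M)" by blast
  show ?case
  proof (cases "act_word \<tau> (lm r g) = M")
    case True
    then have "lc r d dvd lc r g" using assms(5) step(1) unfolding word_dvd_def by blast
    then obtain a where "scal b * act \<tau> g - scal a * act \<delta> d \<in> lead_span r G (underS r M)"
      using generator_rewrite[OF assms(1,2) step(1) assms(3) True assms(4)] by blast
    from lead_span_add[OF this c] show ?thesis
      by (intro exI[of _ "a + c"])
        (simp add: scal_def single_add algebra_simps)
  next
    case False
    then have "act_word \<tau> (lm r g) \<in> underS r M"
      using step(2) by (auto simp: under_def underS_def)
    from lead_span.step[OF step(1) this c, of b] show ?thesis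
      by (intro exI[of _ c]) (simp add: algebra_simps)
  qed
qed

lemma term_dvd_lt_iff:
  fixes f g :: "('x, 'b::comm_ring_1) free_alg"
  assumes "f \<noteq> 0" "g \<noteq> 0"
  shows "term_dvd (lt r g) (lt r f) \<longleftrightarrow> lc r g dvd lc r f \<and> word_dvd (lm r g) (lm r f)"
proof -
  have inj: "Poly_Mapping.single u c = Poly_Mapping.single v d \<longleftrightarrow> u = v \<and> c = d"
    if "c \<noteq> 0" for u v :: "'x list" and c d :: 'b
    using that by (metis lookup_single_eq lookup_single_not_eq)
  show ?thesis
    using lc_nonzero[OF assms(1)] lc_nonzero[OF assms(2)]
    unfolding term_dvd_def lt_def by (auto simp: inj)
qed

text \<open>
  If no leading word divides \<open>M\<close>, or if the coefficient of \<open>\<delta> d\<close> vanishes, \<open>f\<close> has a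
  representation below \<open>M\<close>; otherwise \<open>M\<close> is the leading word of \<open>f\<close> and its coefficient
  is a multiple of \<open>lc d\<close>.
\<close>

lemma lead_span_divisible:
  assumes "sg_polys_reduce bez G" "bezout_function bez" "0 \<notin> G"
    and "f \<in> lead_span r G (under r M)" "f \<noteq> 0"
  shows "\<exists>g\<in>G. term_dvd (lt r g) (lt r f)"
  using wf assms(4)
proof (induction M rule: wf_induct_rule)
  case (less M)
  have descend: ?case if "f \<in> lead_span r G (underS r M)"
    using lead_span_bounded[OF that] assms(5) less.IH by (auto simp: underS_def)
  show ?case
  proof (cases "\<exists>g\<in>G. word_dvd (lm r g) M")
    case False
    from less.prems have "f \<in> lead_span r G (underS r M)"
    proof (rule lead_span_restrict)
      fix g \<tau>
      assume g: "g \<in> G" "act_word \<tau> (lm r g) \<in> under r M"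
      then have "act_word \<tau> (lm r g) \<noteq> M" using False unfolding word_dvd_def by metis
      then show "act_word \<tau> (lm r g) \<in> underS r M"
        using g(2) by (auto simp: under_def underS_def)
    qed
    then show ?thesis by (rule descend)
  next
    case True
    then obtain d where d: "d \<in> G" "word_dvd (lm r d) M"
        "\<And>f. f \<in> G \<Longrightarrow> word_dvd (lm r f) M \<Longrightarrow> lc r d dvd lc r f"
      using dividing_generator[OF assms(1-3)] by blast
    then obtain \<delta> where \<delta>: "act_word \<delta> (lm r d) = M" by (auto simp: word_dvd_def)
    obtain c where c: "f - scal c * act \<delta> d \<in> lead_span r G (underS r M)"
      using lead_span_top[OF assms(1,3) d(1) \<delta> d(3) less.prems] by blast
    have d0: "d \<noteq> 0" using d(1) assms(3) by auto
    show ?thesis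
    proof (cases "c = 0")
      case True
      then show ?thesis using descend c by simp
    next
      case False
      let ?h = "f - scal c * act \<delta> d"
      have h: "Poly_Mapping.keys ?h \<subseteq> underS r M"
        using keys_lead_span[OF assms(3) c] underS_trans by blast
      have f: "f = scal c * act \<delta> d + ?h" by simp
      have "M \<notin> underS r M" by (simp add: underS_def)
      then have "Poly_Mapping.lookup ?h M = 0" using h by (auto simp: in_keys_iff)
      then have lookup: "Poly_Mapping.lookup f M = c * lc r d"
        using lookup_scal_act_lm[of c \<delta> d] \<delta> by (subst f) (simp only: lookup_add add_0_right)
      have "Poly_Mapping.keys f \<subseteq> under r M"
        using keys_add[of "scal c * act \<delta> d" ?h] keys_scal_act_under[OF d0, of c \<delta>] h \<delta>
        unfolding f[symmetric] by (auto simp: under_def underS_def)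
      then have "lm r f = M" using lookup False lc_nonzero[OF d0] by (intro lmI) auto
      then have "term_dvd (lt r d) (lt r f)"
        using d(2) lookup by (simp add: term_dvd_lt_iff[OF assms(5) d0] lc_def)
      then show ?thesis using d(1) by blast
    qed
  qed
qed


section \<open>The two directions\<close>

lemma lead_ideal_subset_if_divisible:
  assumes "0 \<notin> G" "\<And>f. f \<in> I - {0} \<Longrightarrow> \<exists>g\<in>G. term_dvd (lt r g) (lt r f)"
  shows "lead_ideal r I \<subseteq> lead_ideal r G"
  unfolding lead_ideal_def
proof (rule hull_minimal)
  show "lt r ` (I - {0}) \<subseteq> ideal_gen (lt r ` (G - {0}))"
  proof
    fix x assume "x \<in> lt r ` (I - {0})"
    then obtain f where f: "f \<in> I - {0}" "x = lt r f" by blast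
    then obtain g where g: "g \<in> G" "term_dvd (lt r g) (lt r f)" using assms(2) by blast
    then have "g \<noteq> 0" using assms(1) by auto
    then obtain \<tau> a where *: "lm r f = act_word \<tau> (lm r g)" "lc r f = lc r g * a"
      using g(2) f(1) \<open>g \<noteq> 0\<close>
      by (simp add: term_dvd_lt_iff word_dvd_def del: split_paired_Ex) (blast elim: dvdE)
    have "lt r f = scal a * act \<tau> (lt r g)"
      unfolding lt_def * by (cases \<tau>)
        (simp add: scal_def mon_def mult_single plus_list_def mult.commute)
    moreover have "lt r g \<in> ideal_gen (lt r ` (G - {0}))"
      using g(1) \<open>g \<noteq> 0\<close> by (intro hull_inc) auto
    ultimately show "x \<in> ideal_gen (lt r ` (G - {0}))"
      using f(2) ideal_gen_scal_act by simp
  qed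
qed (rule two_sided_ideal_ideal_gen)

lemma strong_groebner_basis_if_sg_polys_reduce:
  assumes "sg_polys_reduce bez G" "bezout_function bez" "0 \<notin> G" "countable G"
  shows "strong_groebner_basis r G (ideal_gen G)"
proof -
  have "\<exists>g\<in>G. term_dvd (lt r g) (lt r f)" if f: "f \<in> ideal_gen G - {0}" for f
  proof -
    have "f \<in> lead_span r G UNIV" using f ideal_gen_subset_lead_span[of G r] by blast
    then obtain M where "f \<in> lead_span r G (under r M)"
      using lead_span_bounded f by blast
    then show ?thesis using lead_span_divisible[OF assms(1-3)] f by blast
  qed
  then show ?thesis
    using assms(3,4) lead_ideal_subset_if_divisible[OF assms(3)]
    unfolding strong_groebner_basis_def groebner_basis_def by blast
qed

text \<open>
  Exact division gives remainder \<open>0\<close>, whose size is below that of \<open>lc f\<close>; this is therefore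
  an admissible reduction step, and it removes the leading word.
\<close>

lemma reduces_to_zero_if_strong:
  fixes G :: "('x, 'a::euclidean_ring_gcd) free_alg set"
  assumes "strong_groebner_basis r G (ideal_gen G)" "f \<in> ideal_gen G"
  shows "reduces_to_zero r G f"
proof -
  have zero: "reduces_to_zero r G 0" by (simp add: reduces_to_zero_def)
  have "\<forall>f. f \<in> ideal_gen G \<and> f \<noteq> 0 \<and> lm r f = M \<longrightarrow> reduces_to_zero r G f" for M
  proof (induction M rule: wf_induct_rule[OF wf])
    case (1 M)
    show ?case
    proof (intro allI impI; elim conjE)
      fix f assume f: "f \<in> ideal_gen G" "f \<noteq> 0" "lm r f = M"
      obtain g where g: "g \<in> G" "term_dvd (lt r g) (lt r f)" "g \<noteq> 0"
        using assms(1) f unfolding strong_groebner_basis_def groebner_basis_def by blast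
      then obtain \<tau> a where *: "lm r f = act_word \<tau> (lm r g)" "lc r f = a * lc r g"
        using f(2)
        by (simp add: term_dvd_lt_iff word_dvd_def mult.commute del: split_paired_Ex)
          (metis dvdE mult.commute)
      let ?h = "f - scal a * act \<tau> g"
      have "a \<noteq> 0" using *(2) lc_nonzero[OF f(2)] by auto
      moreover have "euclidean_size (0::'a) < euclidean_size (lc r f)"
        using lc_nonzero[OF f(2)] by simp
      ultimately have red: "lm_reduction r g f ?h"
        unfolding lm_reduction_def using f(2) g(3) *
        by (intro conjI exI[of _ \<tau>] exI[of _ a] exI[of _ 0]) auto
      have lookup: "Poly_Mapping.lookup ?h M = 0"
        using * lookup_scal_act_lm[of a \<tau> g] f(3)
        by (simp add: lookup_minus lc_def[of r f] del: lookup_scal_mult)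
      have "Poly_Mapping.keys ?h \<subseteq> underS r M"
      proof (rule keys_underS_if_cancel[OF _ lookup])
        from red show "Poly_Mapping.keys ?h \<subseteq> under r M"
          by (rule lm_reduction_props) (simp only: f(3))
      qed
      moreover have "?h \<in> ideal_gen G"
        using ideal_gen_diff[OF f(1) ideal_gen_scal_act] g(1) by (simp add: hull_inc)
      ultimately have "reduces_to_zero r G ?h"
        using 1 zero lm_in_keys[of ?h] by (cases "?h = 0") (auto simp: underS_def)
      then show "reduces_to_zero r G f"
        unfolding reduces_to_zero_def using red g(1)
        by (auto intro: converse_rtranclp_into_rtranclp)
    qed
  qed
  then show ?thesis using assms(2) zero by (cases "f = 0") auto
qed

lemma sg_polys_reduce_if_strong_groebner_basis:
  assumes "strong_groebner_basis r G (ideal_gen G)"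
  shows "sg_polys_reduce bez G"
proof -
  have "reduces_to_zero r G (spoly1 r \<sigma> \<sigma>' f g) \<and> reduces_to_zero r G (gpoly1 r bez \<sigma> \<sigma>' f g)"
    if "f \<in> G" "g \<in> G" for \<sigma> \<sigma>' f g
  proof -
    have "f \<in> ideal_gen G" "g \<in> ideal_gen G" using that by (simp_all add: hull_inc)
    note gens = this[THEN ideal_gen_scal_act]
    show ?thesis
      unfolding spoly1_def gpoly1_def
      by (intro conjI reduces_to_zero_if_strong[OF assms] ideal_gen_add[OF gens] ideal_gen_diff[OF gens])
  qed
  then show ?thesis
    unfolding sg_polys_reduce_def spoly2_eq_spoly1 gpoly2_eq_gpoly1 by (intro ballI conjI allI impI) blast+
qed

end

theorem lemma13:
  fixes r :: "'x::finite list rel"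
    and bez :: "'a::euclidean_ring_gcd \<Rightarrow> 'a \<Rightarrow> 'a \<times> 'a"
    and G :: "('x, 'a) free_alg set"
  assumes "monomial_well_order r"
    and "bezout_function bez"
    and "countable G"
    and "0 \<notin> G"
  shows "strong_groebner_basis r G (ideal_gen G) \<longleftrightarrow>
    (\<forall>f\<in>G. \<forall>g\<in>G.
      (\<forall>t\<in>LCM_words (lm r f) (lm r g). \<forall>\<tau>f \<tau>g.
        act_word \<tau>f (lm r f) = t \<and> act_word \<tau>g (lm r g) = t \<longrightarrow>
          reduces_to_zero r G (spoly1 r \<tau>f \<tau>g f g) \<and>
          reduces_to_zero r G (gpoly1 r bez \<tau>f \<tau>g f g)) \<and>
      (\<forall>w. reduces_to_zero r G (spoly2 r w f g) \<and>
           reduces_to_zero r G (gpoly2 r bez w f g)))"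
proof -
  interpret word_order r by (rule word_order.intro) (rule assms(1))
  have "strong_groebner_basis r G (ideal_gen G) \<longleftrightarrow> sg_polys_reduce bez G"
    by (rule iffI[OF sg_polys_reduce_if_strong_groebner_basis
          strong_groebner_basis_if_sg_polys_reduce[OF _ assms(2,4,3)]])
  then show ?thesis unfolding sg_polys_reduce_def .
qed

end
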